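(* Let $D=(G,\mathcal{O},w)$ be a weighted oriented graph and let $K$ be an induced weighted oriented subgraph of $D$. Then the following conditions are equivalent: (1) there is a strong vertex cover $\mathcal{C}$ of $D$ such that $V(K)\subseteq \mathcal{C}$; (2) there is a generating $\star$-semi-forest $H$ of $K$.
   Context: A weighted oriented graph is a triple $D=(G,\mathcal{O},w)$ with $G$ a finite simple graph, $\mathcal{O}$ an orientation of the edges of $G$, and $w:V(G)\to\mathbb{N}$ (positive integers); $V(D)=V(G)$ and $E(D)$ is the set of oriented edges $(x,y)$. $V^{+}=\{x\in V(D)\mid w(x)>1\}$. $N_D^{+}(x)=\{y\mid (x,y)\in E(D)\}$, $N_D^{-}(x)=\{y\mid (y,x)\in E(D)\}$, $N_D(x)=N_D^+(x)\cup N_D^-(x)$; for $A\subseteq V(D)$, $N_D(A)$ and $N_D^{+}(A)$ are the unions over $a\in A$. A sink is a vertex $x$ with $N_D^+(x)=\emptyset$, a source one with $N_D^-(x)=\emptyset$. Standing convention: every source $x$ has $w(x)=1$. A vertex cover of $D$ is a set $\mathcal{C}\subseteq V(D)$ containing at least one endpoint of every edge. For a vertex cover $\mathcal{C}$: $L_1(\mathcal{C})=\{x\in\mathcal{C}\mid N_D^+(x)\cap (V(D)\setminus\mathcal{C})\neq\emptyset\}$, $L_2(\mathcal{C})=\{x\in\mathcal{C}\setminus L_1(\mathcal{C})\mid N_D^-(x)\cap (V(D)\setminus\mathcal{C})\neq\emptyset\}$, $L_3(\mathcal{C})=\mathcal{C}\setminus(L_1(\mathcal{C})\cup L_2(\mathcal{C}))$.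 $\mathcal{C}$ is strong if for every $x\in L_3(\mathcal{C})$ there is $(y,x)\in E(D)$ with $y\in (\mathcal{C}\setminus L_1(\mathcal{C}))\cap V^{+}$. A weighted oriented subgraph of $D$ is an oriented subgraph of $(G,\mathcal{O})$ with the weights restricted from $w$; it is induced if its underlying graph is an induced subgraph of $G$. For a subgraph $H$, $\deg_H(x)$ is the number of neighbours of $x$ in $H$. An oriented path is a sequence of distinct vertices $(y_1,\dots,y_m)$ with $(y_i,y_{i+1})$ an oriented edge for all $i$; an oriented cycle is $(y_1,\dots,y_m,y_1)$ with $(y_1,\dots,y_m)$ an oriented path and $(y_m,y_1)$ an oriented edge. A unicycle oriented subgraph of $D$ is a weighted oriented subgraph $B$ of $D$ with exactly one cycle $C$ such that: (i) $C$ is an oriented cycle in $B$ and for each $y\in V(B)\setminus V(C)$ there is an oriented path in $B$ from a vertex of $C$ to $y$; (ii) if $x\in V(B)$ and $w(x)=1$ then $\deg_B(x)=1$. A root oriented tree (ROT) with parent $v\in V(T)$ is a weighted oriented subgraph $T$ of $D$ without cycles such that: (i) for each $x\in V(T)\setminus\{v\}$ there is an oriented path in $T$ from $v$ to $x$; (ii) if $x\in V(T)$ and $w(x)=1$, then either ($\deg_T(x)=1$ and $x\neq v$) or ($V(T)=\{v\}$ and $x=v$). A weighted oriented subgraph $H$ of $D$ is a $\star$-semi-forest if there are ROTs $T_1,\dots,T_r$ with parents $v_1,\dots,v_r$ and unicycle oriented subgraphs $B_1,\dots,B_s$ ($r,s\ge 0$) with $H=(\bigcup_i T_i)\cup(\bigcup_j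 B_j)$ such that: (i) $V(T_1),\dots,V(T_r),V(B_1),\dots,V(B_s)$ is a partition of $V(H)$; (ii) there is $W=\{w_1,\dots,w_r\}\subseteq V(D)\setminus V(H)$ with $w_i\in N_D(v_i)$ for each $i$ (possibly $w_i=w_j$ for $i\ne j$); (iii) there is a partition $W_1,W_2$ of $W$ such that $W_1$ is a stable set of $G$, $W_2\subseteq V^{+}$, $(w_i,v_i)\in E(D)$ whenever $w_i\in W_2$, and $N_D^{+}(W_2\cup\tilde H)\cap W_1=\emptyset$, where $\tilde H=\{x\in V(H)\mid \deg_H(x)\ge 2\}\cup\{v_i\mid \deg_H(v_i)=1\}$. For a weighted oriented subgraph $K$ of $D$, a generating $\star$-semi-forest of $K$ is a $\star$-semi-forest $H$ of $D$ with $V(H)=V(K)$. *)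

theory Defs
  imports "Graph_Theory.Digraph_Component" "HOL-Library.Disjoint_Sets"
begin

text \<open>
  An orientation of a finite simple graph is a finite digraph with at most one of the arcs
  \<open>(x, y)\<close>, \<open>(y, x)\<close> for every pair of vertices, i.e. with an asymmetric arc relation; the simple
  graph is recovered by forgetting directions. Weights are kept in a separate function \<open>w\<close>, of
  which only the values on the vertices matter, so that a weighted oriented subgraph of
  \<open>(D, w)\<close> is just a subgraph \<open>H\<close> of \<open>D\<close>, weighted by the same \<open>w\<close>.
\<close>

definition out_nbrs :: "'a pair_pre_digraph \<Rightarrow> 'a \<Rightarrow> 'a set" where
  "out_nbrs D x = {y. (x, y) \<in> parcs D}"

definition in_nbrs :: "'a pair_pre_digraph \<Rightarrow> 'a \<Rightarrow> 'a set" where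
  "in_nbrs D x = {y. (y, x) \<in> parcs D}"

definition nbrs :: "'a pair_pre_digraph \<Rightarrow> 'a \<Rightarrow> 'a set" where
  "nbrs D x = out_nbrs D x \<union> in_nbrs D x"

definition deg :: "'a pair_pre_digraph \<Rightarrow> 'a \<Rightarrow> nat" where
  "deg H x = card (nbrs H x)"

definition source :: "'a pair_pre_digraph \<Rightarrow> 'a \<Rightarrow> bool" where
  "source D x \<longleftrightarrow> x \<in> pverts D \<and> in_nbrs D x = {}"

locale weighted_oriented_graph = pair_digraph D
  for D :: "'a pair_pre_digraph" +
  fixes w :: "'a \<Rightarrow> nat"
  assumes oriented: "asym (parcs D)"
    and weight_pos: "x \<in> pverts D \<Longrightarrow> 0 < w x"
    and weight_source: "source D x \<Longrightarrow> w x = 1"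

definition V_plus :: "'a pair_pre_digraph \<Rightarrow> ('a \<Rightarrow> nat) \<Rightarrow> 'a set" where
  "V_plus D w = {x \<in> pverts D. 1 < w x}"

definition stable_set :: "'a pair_pre_digraph \<Rightarrow> 'a set \<Rightarrow> bool" where
  "stable_set D S \<longleftrightarrow> S \<subseteq> pverts D \<and> (\<forall>x\<in>S. \<forall>y\<in>S. y \<notin> nbrs D x)"

definition vertex_cover :: "'a pair_pre_digraph \<Rightarrow> 'a set \<Rightarrow> bool" where
  "vertex_cover D C \<longleftrightarrow> C \<subseteq> pverts D \<and> (\<forall>(x, y)\<in>parcs D. x \<in> C \<or> y \<in> C)"

definition L1 :: "'a pair_pre_digraph \<Rightarrow> 'a set \<Rightarrow> 'a set" where
  "L1 D C = {x \<in> C. out_nbrs D x \<inter> (pverts D - C) \<noteq> {}}"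

definition L2 :: "'a pair_pre_digraph \<Rightarrow> 'a set \<Rightarrow> 'a set" where
  "L2 D C = {x \<in> C - L1 D C. in_nbrs D x \<inter> (pverts D - C) \<noteq> {}}"

definition L3 :: "'a pair_pre_digraph \<Rightarrow> 'a set \<Rightarrow> 'a set" where
  "L3 D C = C - (L1 D C \<union> L2 D C)"

definition strong_vertex_cover :: "'a pair_pre_digraph \<Rightarrow> ('a \<Rightarrow> nat) \<Rightarrow> 'a set \<Rightarrow> bool" where
  "strong_vertex_cover D w C \<longleftrightarrow> vertex_cover D C \<and>
     (\<forall>x\<in>L3 D C. \<exists>y. (y, x) \<in> parcs D \<and> y \<in> (C - L1 D C) \<inter> V_plus D w)"

text \<open>
  The cycles of the underlying simple graph, each identified with its set of edges. In the
  symmetric closure a cycle in the sense of the library may have length 2 (an edge traversed back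
  and forth); these are not cycles of the simple graph.
\<close>

definition edge_set :: "('a \<times> 'a) awalk \<Rightarrow> 'a set set" where
  "edge_set p = (\<lambda>(x, y). {x, y}) ` set p"

definition cycles :: "'a pair_pre_digraph \<Rightarrow> 'a set set set" where
  "cycles H = {edge_set p | p. pre_digraph.cycle (mk_symmetric H) p \<and> 3 \<le> length p}"

definition unicycle_oriented_subgraph ::
    "'a pair_pre_digraph \<Rightarrow> ('a \<Rightarrow> nat) \<Rightarrow> 'a pair_pre_digraph \<Rightarrow> bool" where
  "unicycle_oriented_subgraph D w B \<longleftrightarrow> subgraph B D \<and>
     (\<exists>c. cycles B = {edge_set c} \<and> pre_digraph.cycle B c \<and>
        (\<forall>y \<in> pverts B - fst ` set c. \<exists>x \<in> fst ` set c. \<exists>p. pre_digraph.apath B x p y)) \<and>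
     (\<forall>x \<in> pverts B. w x = 1 \<longrightarrow> deg B x = 1)"

definition root_oriented_tree ::
    "'a pair_pre_digraph \<Rightarrow> ('a \<Rightarrow> nat) \<Rightarrow> 'a pair_pre_digraph \<Rightarrow> 'a \<Rightarrow> bool" where
  "root_oriented_tree D w T v \<longleftrightarrow> subgraph T D \<and> v \<in> pverts T \<and> cycles T = {} \<and>
     (\<forall>x \<in> pverts T - {v}. \<exists>p. pre_digraph.apath T v p x) \<and>
     (\<forall>x \<in> pverts T. w x = 1 \<longrightarrow> deg T x = 1 \<and> x \<noteq> v \<or> pverts T = {v} \<and> x = v)"

text \<open>
  The indices run over \<open>{..<r}\<close> and \<open>{..<s}\<close>; \<open>u i\<close> is the vertex outside \<open>H\<close> attached to the parent
  \<open>v i\<close>. The blocks \<open>V(T\<^sub>i)\<close>, \<open>V(B\<^sub>j)\<close> are nonempty by definition, whereas \<open>W1\<close> or \<open>W2\<close> may be empty.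
\<close>

definition star_semi_forest ::
    "'a pair_pre_digraph \<Rightarrow> ('a \<Rightarrow> nat) \<Rightarrow> 'a pair_pre_digraph \<Rightarrow> bool" where
  "star_semi_forest D w H \<longleftrightarrow> subgraph H D \<and>
     (\<exists>(r::nat) (s::nat) T v B.
        (\<forall>i<r. root_oriented_tree D w (T i) (v i)) \<and>
        (\<forall>j<s. unicycle_oriented_subgraph D w (B j)) \<and>
        H = \<lparr>pverts = (\<Union>i<r. pverts (T i)) \<union> (\<Union>j<s. pverts (B j)),
             parcs = (\<Union>i<r. parcs (T i)) \<union> (\<Union>j<s. parcs (B j))\<rparr> \<and>
        disjoint_family_on (\<lambda>i. pverts (T i)) {..<r} \<and>
        disjoint_family_on (\<lambda>j. pverts (B j)) {..<s} \<and>
        (\<forall>i<r. \<forall>j<s. pverts (T i) \<inter> pverts (B j) = {}) \<and>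
        (\<exists>u W1 W2.
           (\<forall>i<r. u i \<in> pverts D - pverts H \<and> u i \<in> nbrs D (v i)) \<and>
           W1 \<union> W2 = u ` {..<r} \<and> W1 \<inter> W2 = {} \<and>
           stable_set D W1 \<and> W2 \<subseteq> V_plus D w \<and>
           (\<forall>i<r. u i \<in> W2 \<longrightarrow> (u i, v i) \<in> parcs D) \<and>
           (let H' = {x \<in> pverts H. 2 \<le> deg H x} \<union> {v i | i. i < r \<and> deg H (v i) = 1}
            in (\<Union>x \<in> W2 \<union> H'. out_nbrs D x) \<inter> W1 = {})))"

definition generating_star_semi_forest ::
    "'a pair_pre_digraph \<Rightarrow> ('a \<Rightarrow> nat) \<Rightarrow> 'a pair_pre_digraph \<Rightarrow> 'a pair_pre_digraph \<Rightarrow> bool" where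
  "generating_star_semi_forest D w K H \<longleftrightarrow> star_semi_forest D w H \<and> pverts H = pverts K"

end

theory Submission
  imports Defs
begin

text \<open>
  A strong cover \<open>C\<close> containing \<open>V(K)\<close> assigns to every \<open>x \<in> V(K)\<close> a parent: an in-neighbour in
  \<open>(C - L\<^sub>1(C)) \<inter> V\<^sup>+\<close> if \<open>x \<in> L\<^sub>3(C)\<close>, and a neighbour outside \<open>C\<close> otherwise. The
  parent arcs inside \<open>V(K)\<close> form the required \<open>\<star>\<close>-semi-forest: the components of this functional
  graph are trees rooted at the vertices whose parent lies outside \<open>V(K)\<close>, or contain exactly one
  cycle. Parents outside \<open>C\<close> make up \<open>W\<^sub>1\<close>, those in \<open>C - V(K)\<close> make up \<open>W\<^sub>2\<close>.

  Conversely, the complement of the cover is a maximal stable set among those that contain \<open>W\<^sub>1\<close>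
  and avoid \<open>V(H)\<close>, \<open>W\<^sub>2\<close> and the out-neighbours of the set of parents \<open>H' \<union> W\<^sub>2\<close>, after some
  vertices of \<open>W\<^sub>2\<close> have been moved to \<open>W\<^sub>1\<close>.
\<close>

section \<open>Extending stable sets to complements of strong covers\<close>

text \<open>The complement of a maximal admissible set \<open>M\<close> works: a vertex of
  \<open>L3\<close> has no neighbour in \<open>M\<close>, so without an in-neighbour in
  \<open>P\<close> it would lie outside \<open>A\<close> and could be added to \<open>M\<close>.
  Vertices of \<open>P\<close> avoid \<open>L1\<close> because none of their out-neighbours is in
  \<open>M\<close>.\<close>

lemma extend_supported_to_strong_cover:
  assumes wog: "weighted_oriented_graph D w"
    and "A \<subseteq> pverts D" "P \<subseteq> A \<inter> V_plus D w"
    and "stable_set D S" "S \<inter> A = {}"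
    and "\<And>y. y \<in> P \<Longrightarrow> out_nbrs D y \<inter> S = {}"
    and "\<And>x. x \<in> A \<Longrightarrow> nbrs D x \<inter> S \<noteq> {} \<or> in_nbrs D x \<inter> P \<noteq> {}"
  shows "\<exists>C. strong_vertex_cover D w C \<and> A \<subseteq> C"
proof -
  interpret weighted_oriented_graph D w by (fact wog)
  define \<S> where "\<S> = {M. stable_set D M \<and> S \<subseteq> M \<and> M \<inter> A = {} \<and> (\<forall>y\<in>P. out_nbrs D y \<inter> M = {})}"
  have "finite \<S>"
    by (rule finite_subset[of _ "Pow (pverts D)"])
      (auto simp: \<S>_def stable_set_def pair_finite_verts)
  moreover have "S \<in> \<S>"
    using assms unfolding \<S>_def by blast
  ultimately obtain M where M: "M \<in> \<S>" and max: "\<And>N. N \<in> \<S> \<Longrightarrow> M \<subseteq> N \<Longrightarrow> M = N"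
    using finite_has_maximal[of \<S>] by auto
  define C where "C = pverts D - M"
  have M_verts: "M \<subseteq> pverts D" and compl: "pverts D - C = M"
    using M unfolding \<S>_def stable_set_def C_def by auto
  have P_C: "y \<in> (C - L1 D C) \<inter> V_plus D w" if "y \<in> P" for y
    using that M assms(2,3) compl unfolding \<S>_def L1_def C_def by blast
  have "vertex_cover D C"
    unfolding vertex_cover_def
  proof safe
    fix x y assume "(x, y) \<in> parcs D" "y \<notin> C"
    then show "x \<in> C"
      using M wellformed'[of x y] unfolding \<S>_def stable_set_def C_def nbrs_def out_nbrs_def by auto
  qed (auto simp: C_def)
  moreover have "\<exists>y. (y, x) \<in> parcs D \<and> y \<in> (C - L1 D C) \<inter> V_plus D w" if x: "x \<in> L3 D C" for x
  proof (rule ccontr)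
    assume neg: "\<not> ?thesis"
    have xC: "x \<in> C" and no_nbr: "nbrs D x \<inter> M = {}"
      using x compl unfolding L3_def L2_def L1_def nbrs_def by auto
    have not_in: "in_nbrs D x \<inter> P = {}"
      using neg P_C unfolding in_nbrs_def by blast
    have "x \<notin> A"
      using assms(7)[of x] no_nbr not_in M unfolding \<S>_def by blast
    moreover have "stable_set D (insert x M)"
      using M no_nbr xC pair_no_loops[of "(x, x)"]
      unfolding \<S>_def stable_set_def C_def nbrs_def out_nbrs_def in_nbrs_def by auto
    ultimately have "insert x M \<in> \<S>"
      using M not_in unfolding \<S>_def in_nbrs_def out_nbrs_def by auto
    then show False
      using max[of "insert x M"] xC unfolding C_def by auto
  qed
  moreover have "A \<subseteq> C"
    using M assms(2) unfolding \<S>_def C_def by auto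
  ultimately show ?thesis
    unfolding strong_vertex_cover_def by blast
qed

text \<open>
  A vertex of \<open>Q\<close> with no neighbour in \<open>S\<close> and no in-neighbour in \<open>P \<union> Q\<close> can be moved to \<open>S\<close>:
  the vertices that relied on it as an in-neighbour then have a neighbour in the stable set.
\<close>

lemma extend_to_strong_cover:
  assumes wog: "weighted_oriented_graph D w"
    and A: "A \<subseteq> pverts D" "P \<subseteq> A \<inter> V_plus D w"
  shows "Q \<subseteq> V_plus D w \<Longrightarrow> stable_set D S \<Longrightarrow> S \<inter> (A \<union> Q) = {} \<Longrightarrow> Q \<inter> A = {} \<Longrightarrow>
    (\<And>y. y \<in> P \<union> Q \<Longrightarrow> out_nbrs D y \<inter> S = {}) \<Longrightarrow>
    (\<And>x. x \<in> A \<Longrightarrow> nbrs D x \<inter> S \<noteq> {} \<or> in_nbrs D x \<inter> (P \<union> Q) \<noteq> {}) \<Longrightarrow>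
    \<exists>C. strong_vertex_cover D w C \<and> A \<subseteq> C"
proof (induction "card Q" arbitrary: Q S rule: less_induct)
  case less
  interpret weighted_oriented_graph D w by (fact wog)
  show ?case
  proof (cases "\<forall>x\<in>Q. nbrs D x \<inter> S \<noteq> {} \<or> in_nbrs D x \<inter> (P \<union> Q) \<noteq> {}")
    case True
    \<comment> \<open>Once all of \<open>Q\<close> is supported, \<open>Q\<close> can join both the
      set to be covered and the set of parents.\<close>
    have "\<exists>C. strong_vertex_cover D w C \<and> A \<union> Q \<subseteq> C"
      by (rule extend_supported_to_strong_cover[OF wog, of "A \<union> Q" "P \<union> Q" S])
        (use A less.prems True in \<open>auto simp: V_plus_def\<close>)
    then show ?thesis by blast
  next
    case False
    then obtain x where x: "x \<in> Q" "nbrs D x \<inter> S = {}" "in_nbrs D x \<inter> (P \<union> Q) = {}"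
      by auto
    have "finite Q"
      using less.prems(1) pair_finite_verts by (auto simp: V_plus_def intro: finite_subset)
    then have "card (Q - {x}) < card Q"
      using x(1) by (rule card_Diff1_less)
    moreover have "stable_set D (insert x S)"
      using less.prems(1,2) x pair_no_loops[of "(x, x)"]
      unfolding stable_set_def V_plus_def nbrs_def out_nbrs_def in_nbrs_def by auto
    moreover have "nbrs D a \<inter> insert x S \<noteq> {} \<or> in_nbrs D a \<inter> (P \<union> (Q - {x})) \<noteq> {}"
      if "a \<in> A" for a
      using less.prems(6)[OF that] unfolding nbrs_def by blast
    moreover have "out_nbrs D y \<inter> insert x S = {}" if "y \<in> P \<union> (Q - {x})" for y
      using less.prems(5)[of y] that x(3) unfolding out_nbrs_def in_nbrs_def by blast
    ultimately show ?thesis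
      using less.hyps[of "Q - {x}" "insert x S"] less.prems(1,3,4) x(1) by blast
  qed
qed

section \<open>From semi-forests to strong covers\<close>

lemma subgraph_pair_iff:
  "subgraph (with_proj H) (with_proj G) \<longleftrightarrow>
     pverts H \<subseteq> pverts G \<and> parcs H \<subseteq> parcs G \<and> pair_wf_digraph G \<and> pair_wf_digraph H"
  by (auto simp: subgraph_def compatible_def wf_digraph_def pair_wf_digraph_def)

lemma pawalk_verts_eq: "pcas u p v \<Longrightarrow> pawalk_verts u p = u # map snd p"
  by (induction p arbitrary: u) auto

lemma pcas_nth:
  "pcas u p v \<Longrightarrow> i < length p \<Longrightarrow> fst (p ! i) = (if i = 0 then u else snd (p ! (i - 1)))"
  by (induction p arbitrary: u i) (auto simp: nth_Cons split: nat.splits)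

lemma pcas_last: "pcas u p v \<Longrightarrow> p \<noteq> [] \<Longrightarrow> snd (last p) = v"
  by (induction p arbitrary: u) auto

lemma cycle_pair_iff:
  "pre_digraph.cycle (with_proj G) p \<longleftrightarrow>
     (\<exists>u\<in>pverts G. set p \<subseteq> parcs G \<and> pcas u p u \<and> distinct (map snd p) \<and> p \<noteq> [])"
  by (auto simp: pre_digraph.cycle_def pre_digraph.awalk_def cas_with_proj_eq
      awalk_verts_with_proj_eq pawalk_verts_eq)

text \<open>A sequence indexed by all naturals, injective modulo the length, spares every later
  argument the case distinction at the closing arc.\<close>

lemma cycle_cyclic_sequence:
  assumes "pre_digraph.cycle (with_proj G) p"
  obtains x where "set p = range (\<lambda>i. (x i, x (Suc i)))"
    and "\<And>i j. x i = x j \<longleftrightarrow> i mod length p = j mod length p"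
proof
  define k where "k = length p"
  \<comment> \<open>\<open>x i\<close> is the head of arc \<open>i\<close>, so the arc joining
    \<open>x i\<close> to \<open>x (Suc i)\<close> is number \<open>Suc i\<close> modulo
    \<open>k\<close>.\<close>
  define x where "x i = snd (p ! (i mod k))" for i
  obtain u where u: "pcas u p u" "distinct (map snd p)" "p \<noteq> []"
    using assms by (auto simp: cycle_pair_iff)
  then have k: "k > 0" by (simp add: k_def)
  show "x i = x j \<longleftrightarrow> i mod length p = j mod length p" for i j
    using u(2) k nth_eq_iff_index_eq[of "map snd p" "i mod k" "j mod k"]
    unfolding x_def k_def by simp
  have step: "p ! (Suc i mod k) = (x i, x (Suc i))" for i
  proof -
    have "fst (p ! (Suc i mod k)) = x i"
    proof (cases "Suc i mod k = 0")
      case True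
      then have "i mod k = k - 1"
        by (metis diff_Suc_1 mod_Suc nat.distinct(1))
      then show ?thesis
        using True pcas_nth[OF u(1), of 0] pcas_last[OF u(1,3)] u(3) k
        by (simp add: x_def k_def last_conv_nth)
    next
      case False
      then have "Suc i mod k = Suc (i mod k)"
        by (simp add: mod_Suc split: if_splits)
      then show ?thesis
        using False pcas_nth[OF u(1), of "Suc i mod k"] mod_less_divisor[OF k, of "Suc i"]
        by (simp add: x_def k_def)
    qed
    then show ?thesis by (simp add: x_def prod_eq_iff)
  qed
  show "set p = range (\<lambda>i. (x i, x (Suc i)))"
  proof (intro equalityI subsetI)
    fix e assume "e \<in> set p"
    then obtain i where "i < k" "e = p ! i" by (auto simp: in_set_conv_nth k_def)
    \<comment> \<open>\<open>i + k - 1\<close> stands for the index before \<open>i\<close> modulo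
      \<open>k\<close>; adding \<open>k > 0\<close> avoids truncated subtraction at
      \<open>i = 0\<close>.\<close>
    then have "e = p ! (Suc (i + k - 1) mod k)" using k by simp
    then show "e \<in> range (\<lambda>i. (x i, x (Suc i)))" unfolding step by blast
  next
    fix e assume "e \<in> range (\<lambda>i. (x i, x (Suc i)))"
    then obtain i where "e = p ! (Suc i mod k)" using step by auto
    then show "e \<in> set p" using k by (simp add: k_def)
  qed
qed


section \<open>In-arcs in trees and unicycles\<close>

lemma apath_in_arc:
  assumes "pre_digraph.apath (with_proj G) u p x" "u \<noteq> x"
  shows "\<exists>y. (y, x) \<in> parcs G"
proof -
  have p: "set p \<subseteq> parcs G" "pcas u p x"
    using assms(1)
    by (auto simp: pre_digraph.apath_def pre_digraph.awalk_def cas_with_proj_eq)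
  then have "p \<noteq> []" using assms(2) by auto
  then have "last p \<in> parcs G" "snd (last p) = x"
    using p pcas_last[of u p x] last_in_set by auto
  then show ?thesis by (metis prod.collapse)
qed

lemma root_oriented_tree_in_arc:
  assumes "root_oriented_tree D w T v" "x \<in> pverts T" "x \<noteq> v"
  shows "\<exists>y. (y, x) \<in> parcs T"
  using assms apath_in_arc unfolding root_oriented_tree_def by (metis Diff_iff singletonD)

text \<open>On the cycle, the preceding cycle arc serves; elsewhere, the last arc of a path from the
  cycle does.\<close>

lemma unicycle_oriented_subgraph_in_arc:
  assumes "unicycle_oriented_subgraph D w B" "x \<in> pverts B"
  shows "\<exists>y. (y, x) \<in> parcs B"
proof -
  obtain c where c: "pre_digraph.cycle (with_proj B) c"
    and reach: "\<And>y. y \<in> pverts B - fst ` set c \<Longrightarrow>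
      \<exists>x \<in> fst ` set c. \<exists>p. pre_digraph.apath (with_proj B) x p y"
    using assms(1) unfolding unicycle_oriented_subgraph_def by auto
  show ?thesis
  proof (cases "x \<in> fst ` set c")
    case True
    obtain g where g: "set c = range (\<lambda>i. (g i, g (Suc i)))"
      and gm: "\<And>i j. g i = g j \<longleftrightarrow> i mod length c = j mod length c"
      using cycle_cyclic_sequence[OF c] by blast
    have sub: "set c \<subseteq> parcs B" and "c \<noteq> []"
      using c by (auto simp: cycle_pair_iff)
    obtain i where "x = g i" using True g by auto
    then have "x = g (Suc (i + length c - 1))"
      using \<open>c \<noteq> []\<close> by (simp add: gm)
    then have "(g (i + length c - 1), x) \<in> set c"
      unfolding g by blast
    then show ?thesis using sub by blast
  next
    case False
    then obtain z p where "z \<in> fst ` set c" "pre_digraph.apath (with_proj B) z p x"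
      using reach assms(2) by blast
    then show ?thesis using apath_in_arc[of B z p x] False by auto
  qed
qed

section \<open>The strong cover of a semi-forest\<close>

context weighted_oriented_graph
begin

lemma finite_nbrs:
  assumes "parcs H \<subseteq> parcs D"
  shows "finite (nbrs H x)"
proof (rule finite_subset)
  show "nbrs H x \<subseteq> pverts D"
    using assms wellformed' by (auto simp: nbrs_def out_nbrs_def in_nbrs_def)
qed (rule pair_finite_verts)

lemma deg_ge_2:
  assumes "parcs H \<subseteq> parcs D" "(a, b) \<in> parcs H" "(b, c) \<in> parcs H"
  shows "2 \<le> deg H b"
proof -
  have "a \<noteq> c"
    using assms oriented by (auto dest: asymD)
  then have "card {a, c} = 2" by simp
  moreover have "{a, c} \<subseteq> nbrs H b"
    using assms by (auto simp: nbrs_def out_nbrs_def in_nbrs_def)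
  ultimately show ?thesis
    unfolding deg_def using card_mono[OF finite_nbrs[OF assms(1)]] by metis
qed

text \<open>This is \<open>extend_to_strong_cover\<close> with \<open>A = pverts H\<close>, stable
  set \<open>W1\<close> and movable set \<open>W2\<close>; the work lies in showing that every
  vertex of \<open>H\<close> is supported.\<close>

lemma strong_cover_of_star_semi_forest:
  assumes "star_semi_forest D w H"
  shows "\<exists>C. strong_vertex_cover D w C \<and> pverts H \<subseteq> C"
proof -
  obtain r s :: nat and T v B u W1 W2 where
    sub: "subgraph (with_proj H) (with_proj D)"
    and T: "\<And>i. i < r \<Longrightarrow> root_oriented_tree D w (T i) (v i)"
    and B: "\<And>j. j < s \<Longrightarrow> unicycle_oriented_subgraph D w (B j)"
    and H: "H = \<lparr>pverts = (\<Union>i<r. pverts (T i)) \<union> (\<Union>j<s. pverts (B j)),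
             parcs = (\<Union>i<r. parcs (T i)) \<union> (\<Union>j<s. parcs (B j))\<rparr>"
    and disjT: "disjoint_family_on (\<lambda>i. pverts (T i)) {..<r}"
    and disjB: "disjoint_family_on (\<lambda>j. pverts (B j)) {..<s}"
    and disjTB: "\<forall>i<r. \<forall>j<s. pverts (T i) \<inter> pverts (B j) = {}"
    and u: "\<And>i. i < r \<Longrightarrow> u i \<in> pverts D - pverts H \<and> u i \<in> nbrs D (v i)"
    and W: "W1 \<union> W2 = u ` {..<r}" "W1 \<inter> W2 = {}" "stable_set D W1" "W2 \<subseteq> V_plus D w"
    and W2: "\<And>i. i < r \<Longrightarrow> u i \<in> W2 \<Longrightarrow> (u i, v i) \<in> parcs D"
    and N: "(\<Union>x \<in> W2 \<union> ({x \<in> pverts H. 2 \<le> deg H x} \<union> {v i | i. i < r \<and> deg H (v i) = 1}).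
              out_nbrs D x) \<inter> W1 = {}"
    using assms unfolding star_semi_forest_def Let_def by (elim conjE exE) blast
  \<comment> \<open>\<open>P\<close> contains the tail of every arc of \<open>H\<close>
    (\<open>PT\<close>, \<open>PB\<close>), and all its vertices have weight above 1
    (\<open>PV\<close>), so it can serve as the set of parents.\<close>
  define P where "P = {x \<in> pverts H. 2 \<le> deg H x} \<union> {v i | i. i < r \<and> deg H (v i) = 1}"
  have wfT: "pair_wf_digraph (T i)" "parcs (T i) \<subseteq> parcs D" "v i \<in> pverts (T i)" if "i < r" for i
    using T[OF that] by (auto simp: root_oriented_tree_def subgraph_pair_iff)
  have wfB: "pair_wf_digraph (B j)" "parcs (B j) \<subseteq> parcs D" if "j < s" for j
    using B[OF that] by (auto simp: unicycle_oriented_subgraph_def subgraph_pair_iff)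
  have arcT: "x \<in> pverts (T i)" "y \<in> pverts (T i)" if "(x, y) \<in> parcs (T i)" "i < r" for x y i
    using pair_wf_digraph.wellformed'[OF wfT(1)] that by blast+
  have arcB: "x \<in> pverts (B j)" "y \<in> pverts (B j)" if "(x, y) \<in> parcs (B j)" "j < s" for x y j
    using pair_wf_digraph.wellformed'[OF wfB(1)] that by blast+
  have TT: "i = i'" if "x \<in> pverts (T i)" "x \<in> pverts (T i')" "i < r" "i' < r" for x i i'
    using disjT that by (auto simp: disjoint_family_on_def)
  have BB: "j = j'" if "x \<in> pverts (B j)" "x \<in> pverts (B j')" "j < s" "j' < s" for x j j'
    using disjB that by (auto simp: disjoint_family_on_def)
  have TB: False if "x \<in> pverts (T i)" "x \<in> pverts (B j)" "i < r" "j < s" for x i j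
    using disjTB that by auto
  \<comment> \<open>Blocks are vertex-disjoint and arcs stay inside their block, so degrees in
    \<open>H\<close> can be computed blockwise.\<close>
  have degT: "deg H x = deg (T i) x" if "i < r" "x \<in> pverts (T i)" for i x
  proof -
    have "(x, y) \<in> parcs H \<longleftrightarrow> (x, y) \<in> parcs (T i)" "(y, x) \<in> parcs H \<longleftrightarrow> (y, x) \<in> parcs (T i)" for y
      using that arcT arcB TT TB by (auto simp: H) metis+
    then show ?thesis by (simp add: deg_def nbrs_def out_nbrs_def in_nbrs_def)
  qed
  have degB: "deg H x = deg (B j) x" if "j < s" "x \<in> pverts (B j)" for j x
  proof -
    have "(x, y) \<in> parcs H \<longleftrightarrow> (x, y) \<in> parcs (B j)" "(y, x) \<in> parcs H \<longleftrightarrow> (y, x) \<in> parcs (B j)" for y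
      using that arcT arcB BB TB by (auto simp: H) metis+
    then show ?thesis by (simp add: deg_def nbrs_def out_nbrs_def in_nbrs_def)
  qed
  have subH: "pverts H \<subseteq> pverts D" "parcs H \<subseteq> parcs D"
    using sub by (auto simp: subgraph_pair_iff)
  \<comment> \<open>A vertex of weight 1 is a leaf other than a parent \<open>v i\<close>, or an
    isolated one-vertex tree; neither lies in \<open>P\<close>.\<close>
  have PV: "x \<in> pverts H \<inter> V_plus D w" if xP: "x \<in> P" for x
  proof -
    have xH: "x \<in> pverts H"
      using xP wfT(3) by (auto simp: P_def H)
    have "w x \<noteq> 1"
    proof
      assume w1: "w x = 1"
      consider i where "i < r" "x \<in> pverts (T i)" | j where "j < s" "x \<in> pverts (B j)"
        using xH by (auto simp: H)
      then show False
      proof cases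
        case 1
        consider "deg (T i) x = 1" "x \<noteq> v i" | "pverts (T i) = {v i}" "x = v i"
          using T[OF 1(1)] w1 1(2) unfolding root_oriented_tree_def by blast
        then show False
        proof cases
          case a: 1
          then obtain i' where "i' < r" "x = v i'"
            using xP degT[OF 1] by (auto simp: P_def)
          then show False using a TT[OF 1(2) _ 1(1)] wfT(3) by metis
        next
          case 2
          have "(x, y) \<notin> parcs (T i) \<and> (y, x) \<notin> parcs (T i)" for y
          proof (rule ccontr)
            assume "\<not> ?thesis"
            then have "(x, x) \<in> parcs D"
              using arcT[OF _ 1(1), of x y] arcT[OF _ 1(1), of y x] 2 wfT(2)[OF 1(1)] by auto
            then show False using pair_no_loops by fastforce
          qed
          then have "nbrs (T i) x = {}"
            by (simp add: nbrs_def out_nbrs_def in_nbrs_def)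
          then have "deg H x = 0" using degT[OF 1] by (simp add: deg_def)
          then show False using xP by (auto simp: P_def)
        qed
      next
        case 2
        then have "deg H x = 1"
          using B[OF 2(1)] w1 degB[OF 2] by (simp add: unicycle_oriented_subgraph_def)
        then obtain i where "i < r" "x = v i"
          using xP by (auto simp: P_def)
        then show False using TB[of x i j] 2 wfT(3) by blast
      qed
    qed
    then show ?thesis
      using xH subH weight_pos[of x] by (auto simp: V_plus_def)
  qed
  \<comment> \<open>A root with a child has positive degree; any other vertex with a child also has
    an in-arc, hence degree at least 2.\<close>
  have PT: "y \<in> P" if yx: "i < r" "(y, x) \<in> parcs (T i)" for i x y
  proof -
    have y: "y \<in> pverts (T i)" "y \<in> pverts H"
      using arcT[OF yx(2,1)] yx(1) by (auto simp: H)
    show ?thesis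
    proof (cases "y = v i")
      case True
      have "x \<in> nbrs H y"
        using yx by (auto simp: H nbrs_def out_nbrs_def)
      then have "deg H y \<noteq> 0"
        using finite_nbrs[OF subH(2)] by (auto simp: deg_def)
      then have "2 \<le> deg H y \<or> deg H y = 1" by linarith
      then show ?thesis using y True yx(1) by (auto simp: P_def)
    next
      case False
      then obtain z where "(z, y) \<in> parcs (T i)"
        using root_oriented_tree_in_arc[OF T[OF yx(1)] y(1)] by auto
      then have "2 \<le> deg H y"
        using deg_ge_2[OF wfT(2)[OF yx(1)] _ yx(2)] degT[OF yx(1) y(1)] by simp
      then show ?thesis using y by (simp add: P_def)
    qed
  qed
  have PB: "y \<in> P" if yx: "j < s" "(y, x) \<in> parcs (B j)" for j x y
  proof -
    have y: "y \<in> pverts (B j)" "y \<in> pverts H"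
      using arcB[OF yx(2,1)] yx(1) by (auto simp: H)
    then obtain z where "(z, y) \<in> parcs (B j)"
      using unicycle_oriented_subgraph_in_arc[OF B[OF yx(1)]] by auto
    then have "2 \<le> deg H y"
      using deg_ge_2[OF wfB(2)[OF yx(1)] _ yx(2)] degB[OF yx(1) y(1)] by simp
    then show ?thesis using y by (simp add: P_def)
  qed
  \<comment> \<open>The root \<open>v i\<close> is supported by \<open>u i\<close>, a neighbour in
    \<open>W1\<close> or an in-neighbour in \<open>W2\<close>; every other vertex by an in-arc of
    its block.\<close>
  have supp: "nbrs D x \<inter> W1 \<noteq> {} \<or> in_nbrs D x \<inter> (P \<union> W2) \<noteq> {}" if xH: "x \<in> pverts H" for x
  proof -
    consider i where "i < r" "x = v i" | i where "i < r" "x \<in> pverts (T i)" "x \<noteq> v i"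
      | j where "j < s" "x \<in> pverts (B j)"
      using xH by (auto simp: H)
    then show ?thesis
    proof cases
      case 1
      then have "u i \<in> W1 \<or> u i \<in> W2" using W(1) by auto
      then show ?thesis
        using 1 u[of i] W2[of i] by (auto simp: in_nbrs_def)
    next
      case 2
      then obtain y where "(y, x) \<in> parcs (T i)"
        using root_oriented_tree_in_arc[OF T] by blast
      then show ?thesis
        using PT[OF 2(1)] wfT(2)[OF 2(1)] by (auto simp: in_nbrs_def)
    next
      case 3
      then obtain y where "(y, x) \<in> parcs (B j)"
        using unicycle_oriented_subgraph_in_arc[OF B] by blast
      then show ?thesis
        using PB[OF 3(1)] wfB(2)[OF 3(1)] by (auto simp: in_nbrs_def)
    qed
  qed
  have out: "\<forall>x \<in> pverts H. x \<notin> W1 \<union> W2"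
    using W(1) u by auto
  show ?thesis
  proof (rule extend_to_strong_cover[OF weighted_oriented_graph_axioms subH(1), of P W2 W1])
    show "P \<subseteq> pverts H \<inter> V_plus D w" using PV by blast
    show "W1 \<inter> (pverts H \<union> W2) = {}" "W2 \<inter> pverts H = {}" using out W(2) by auto
    show "out_nbrs D y \<inter> W1 = {}" if "y \<in> P \<union> W2" for y
      using N that unfolding P_def by blast
  qed (use W supp in auto)
qed

end


section \<open>Components of functional graphs\<close>

text \<open>
  In the functional graph of \<open>f\<close>, restricted to \<open>V\<close> and with its arcs running from \<open>f x\<close> to \<open>x\<close>,
  every component consists of the descendants of a root (a vertex mapped outside \<open>V\<close>) or of a
  periodic vertex; the former is a tree, the latter contains exactly one cycle.
\<close>

locale parent_map =
  fixes V :: "'a set" and f :: "'a \<Rightarrow> 'a"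
  assumes finite_V: "finite V"
    and no_2_cycle: "x \<in> V \<Longrightarrow> f x \<in> V \<Longrightarrow> f (f x) \<noteq> x"
begin

definition R :: "'a rel" where
  "R = {(f x, x) | x. x \<in> V \<and> f x \<in> V}"

definition roots :: "'a set" where
  "roots = {z \<in> V. f z \<notin> V}"

definition periodic :: "'a set" where
  "periodic = {z. (z, z) \<in> R\<^sup>+}"

definition desc :: "'a \<Rightarrow> 'a set" where
  "desc z = {y \<in> V. (z, y) \<in> R\<^sup>*}"

definition block :: "'a \<Rightarrow> 'a pair_pre_digraph" where
  "block z = \<lparr>pverts = desc z, parcs = R \<inter> desc z \<times> desc z\<rparr>"

lemma R_iff: "(a, b) \<in> R \<longleftrightarrow> b \<in> V \<and> a = f b \<and> f b \<in> V"
  by (auto simp: R_def)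

lemma periodic_in_V: "z \<in> periodic \<Longrightarrow> z \<in> V"
  by (auto simp: periodic_def R_iff dest: tranclD)

lemma periodic_not_root: "z \<in> periodic \<Longrightarrow> f z \<in> V"
  by (auto simp: periodic_def R_iff dest!: tranclD2)

lemma self_in_desc: "z \<in> V \<Longrightarrow> z \<in> desc z"
  by (simp add: desc_def)

text \<open>The only possible arc into \<open>x\<close> comes from \<open>f x\<close>, so walking
  backwards along \<open>R\<close> is iterating \<open>f\<close>.\<close>

lemma ancestor_of_invariant:
  assumes "(a, x) \<in> R\<^sup>*" "x \<in> Z" "\<And>y. y \<in> Z \<Longrightarrow> f y \<in> Z"
  shows "a \<in> Z"
  using assms(1) by (induction rule: converse_rtrancl_induct) (auto simp: R_iff assms)

lemma ancestor_of_root: "(a, z) \<in> R\<^sup>* \<Longrightarrow> z \<in> roots \<Longrightarrow> a = z"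
  by (erule rtranclE) (auto simp: R_iff roots_def)

text \<open>Walking back from \<open>z\<close> never leaves its cycle: the unique predecessor of a
  vertex \<open>b\<close> is the last vertex but one on a nonempty walk from \<open>z\<close> to
  \<open>b\<close>.\<close>

lemma ancestor_of_periodic:
  assumes "(a, z) \<in> R\<^sup>*" "z \<in> periodic"
  shows "(z, a) \<in> R\<^sup>*"
  using assms(1)
proof (induction rule: converse_rtrancl_induct)
  case (step a b)
  have "(z, b) \<in> R\<^sup>+"
    using step.IH assms(2) by (auto simp: periodic_def rtrancl_eq_or_trancl)
  then obtain c where "(z, c) \<in> R\<^sup>*" "(c, b) \<in> R"
    using tranclD2 by metis
  then show ?case using step.hyps(1) by (simp add: R_iff)
qed simp

text \<open>In-arcs are unique, so the ancestors of \<open>y\<close> form a chain and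
  \<open>a\<close>, \<open>b\<close> are comparable. Every ancestor of a root or periodic vertex is
  reachable from it, which gives the other direction.\<close>

lemma desc_meet:
  assumes "y \<in> desc a" "y \<in> desc b" "a \<in> roots \<union> periodic" "b \<in> roots \<union> periodic"
  shows "(a, b) \<in> R\<^sup>* \<and> (b, a) \<in> R\<^sup>*"
proof -
  have "single_valued (R\<inverse>)"
    by (auto simp: single_valued_def R_iff)
  then have "(a, b) \<in> R\<^sup>* \<or> (b, a) \<in> R\<^sup>*"
    using single_valued_confluent[of "R\<inverse>" y a b] assms(1,2)
    by (auto simp: desc_def rtrancl_converse)
  then show ?thesis
    using assms(3,4) ancestor_of_root ancestor_of_periodic by blast
qed

lemma desc_eqI:
  assumes "y \<in> desc a" "y \<in> desc b" "a \<in> roots \<union> periodic" "b \<in> roots \<union> periodic"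
  shows "desc a = desc b"
  using desc_meet[OF assms] by (auto simp: desc_def intro: rtrancl_trans)

lemma desc_roots_disjoint:
  assumes "y \<in> desc a" "y \<in> desc b" "a \<in> roots" "b \<in> roots \<union> periodic"
  shows "a = b \<and> b \<notin> periodic"
  using desc_meet[OF assms(1,2) UnI1[OF assms(3)] assms(4)] assms(3) ancestor_of_root
    periodic_not_root by (auto simp: roots_def)

text \<open>Going back from \<open>y\<close> in the finite set \<open>V\<close> must end at a root
  or run into a cycle. Otherwise \<open>R\<close> on the ancestors of \<open>y\<close> would be
  well-founded, yet a minimal ancestor \<open>z\<close> would still have the predecessor
  \<open>f z\<close>.\<close>

lemma desc_cover:
  assumes "y \<in> V"
  shows "\<exists>z \<in> roots \<union> periodic. y \<in> desc z"
proof (rule ccontr)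
  assume neg: "\<not> ?thesis"
  define A where "A = {z \<in> V. (z, y) \<in> R\<^sup>*}"
  have A: "f z \<in> A" "z \<notin> periodic" if "z \<in> A" for z
  proof -
    have "z \<in> V" "(z, y) \<in> R\<^sup>*" using that by (auto simp: A_def)
    then show "z \<notin> periodic" using neg assms by (auto simp: desc_def)
    have "z \<notin> roots" using \<open>(z, y) \<in> R\<^sup>*\<close> neg assms by (auto simp: desc_def)
    then have "(f z, z) \<in> R" using \<open>z \<in> V\<close> by (auto simp: R_iff roots_def)
    then show "f z \<in> A" using \<open>(z, y) \<in> R\<^sup>*\<close>
      by (auto simp: A_def R_iff intro: converse_rtrancl_into_rtrancl)
  qed
  define RA where "RA = R \<inter> A \<times> A"
  have "RA \<subseteq> V \<times> V" by (auto simp: RA_def R_iff)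
  then have "finite RA" using finite_V by (auto intro: finite_subset)
  moreover have "acyclic RA"
  proof (rule acyclicI, intro allI notI)
    fix x assume "(x, x) \<in> RA\<^sup>+"
    then have "(x, x) \<in> R\<^sup>+" "x \<in> A"
      by (auto simp: RA_def intro: trancl_mono dest: tranclD)
    then show False using A(2) by (auto simp: periodic_def)
  qed
  ultimately have "wf RA" by (rule finite_acyclic_wf)
  moreover have "y \<in> A" using assms by (simp add: A_def)
  ultimately obtain z where "z \<in> A" "\<And>x. (x, z) \<in> RA \<Longrightarrow> x \<notin> A"
    by (meson wf_eq_minimal)
  moreover from \<open>z \<in> A\<close> have "(f z, z) \<in> RA"
    using A(1) by (auto simp: RA_def R_iff A_def)
  ultimately show False using A(1) by blast
qed

text \<open>Even for \<open>x = z\<close> there is a nonempty walk from \<open>z\<close> to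
  \<open>x\<close>, since \<open>f z\<close> in \<open>V\<close> makes \<open>z\<close> periodic;
  its last vertex but one is \<open>f x\<close>.\<close>

lemma parent_arc_in_block:
  assumes "x \<in> desc z" "f x \<in> V" "z \<in> roots \<union> periodic"
  shows "(f x, x) \<in> parcs (block z)"
proof -
  have xV: "x \<in> V" and zx: "(z, x) \<in> R\<^sup>*"
    using assms(1) by (auto simp: desc_def)
  have "(z, x) \<in> R\<^sup>+"
    using zx assms(2,3) by (auto simp: rtrancl_eq_or_trancl roots_def periodic_def)
  then obtain b where "(z, b) \<in> R\<^sup>*" "(b, x) \<in> R"
    using tranclD2 by metis
  then show ?thesis
    using xV assms by (auto simp: block_def desc_def R_iff)
qed

section \<open>Paths and cycles inside a block\<close>

lemma wf_block: "pair_wf_digraph (block z)"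
  by unfold_locales (auto simp: block_def)

lemma trancl_block:
  assumes "(z, y) \<in> R\<^sup>+" "z \<in> V"
  shows "(z, y) \<in> (parcs (block z))\<^sup>+"
  using assms(1)
proof (induction rule: trancl_induct)
  case (base y)
  then have "(z, y) \<in> parcs (block z)"
    using assms(2) by (auto simp: block_def desc_def R_iff)
  then show ?case by (rule r_into_trancl)
next
  case (step y x)
  then have "(y, x) \<in> parcs (block z)"
    by (auto simp: block_def desc_def R_iff intro: trancl_into_rtrancl rtrancl_into_rtrancl)
  with step.IH show ?case by (rule trancl_into_trancl)
qed

lemma apath_block:
  assumes "y \<in> desc z" "z \<in> V"
  shows "\<exists>p. pre_digraph.apath (with_proj (block z)) z p y"
proof -
  interpret pair_wf_digraph "block z" by (rule wf_block)
  have "z = y \<or> (z, y) \<in> (parcs (block z))\<^sup>+"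
    using assms trancl_block by (auto simp: desc_def rtrancl_eq_or_trancl)
  then have "z \<rightarrow>\<^sup>*\<^bsub>with_proj (block z)\<^esub> y"
  proof
    assume "z = y"
    moreover have "y \<in> pverts (block z)" using assms(1) by (simp add: block_def)
    ultimately show ?thesis using reachable_refl by metis
  next
    assume "(z, y) \<in> (parcs (block z))\<^sup>+"
    then show ?thesis by (rule reachable1_reachable)
  qed
  then show ?thesis by (simp add: reachable_apath)
qed

text \<open>
  Along a cycle, once a step goes from \<open>f y\<close> to \<open>y\<close> the next one cannot go back to \<open>f y\<close>, so it
  leads to a preimage of \<open>y\<close>. Hence \<open>f\<close> is either the successor or the predecessor map throughout.
\<close>

lemma cycle_is_orbit:
  assumes p: "pre_digraph.cycle (with_proj (mk_symmetric (with_proj (block z)))) p" "3 \<le> length p"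
  shows "f z \<in> V" "z \<in> fst ` set p"
    "edge_set p = (\<lambda>x. {x, f x}) ` range (\<lambda>n. (f ^^ n) z)"
proof -
  define k where "k = length p"
  obtain g where g: "set p = range (\<lambda>i. (g i, g (Suc i)))"
    and gm: "\<And>i j. g i = g j \<longleftrightarrow> i mod k = j mod k"
    using cycle_cyclic_sequence[OF p(1)] k_def by metis
  define Z where "Z = range g"
  have fst_p: "fst ` set p = Z"
    unfolding g Z_def by (auto simp: image_image)
  have arcs: "set p \<subseteq> {(a, b). {a, b} \<subseteq> desc z \<and> ((a, b) \<in> R \<or> (b, a) \<in> R)}"
    using p(1) by (auto simp: cycle_pair_iff parcs_mk_symmetric block_def)
  have adj: "g (Suc i) = f (g i) \<or> g i = f (g (Suc i))" for i
    using arcs unfolding g by (auto simp: R_iff)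
  have ZV: "Z \<subseteq> desc z"
    using arcs unfolding g Z_def by auto
  have shift: "g (i + k * j) = g i" for i j
    by (simp add: gm)
  have neq: "g (Suc (Suc i)) \<noteq> g i" for i
  proof
    assume "g (Suc (Suc i)) = g i"
    then have "(i + 2) mod k = i mod k" by (simp add: gm)
    then have "k dvd 2" by (metis add_diff_cancel_left' le_add1 mod_eq_dvd_iff_nat)
    then show False using p(2) by (auto simp: k_def dest: dvd_imp_le)
  qed
  have dir: "(\<forall>i. g (Suc i) = f (g i)) \<or> (\<forall>i. g i = f (g (Suc i)))"
  proof (cases "\<exists>i. g i = f (g (Suc i))")
    case True
    then obtain i where i: "g i = f (g (Suc i))" ..
    have down: "g (i + n) = f (g (Suc (i + n)))" for n
    proof (induction n)
      case (Suc n)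
      then show ?case using adj[of "Suc (i + n)"] neq[of "i + n"] by auto
    qed (simp add: i)
    \<comment> \<open>Going round \<open>i\<close> more times moves \<open>j\<close> to an index at
      least \<open>i\<close>, where the direction is already known.\<close>
    have "g j = f (g (Suc j))" for j
    proof -
      have "j + k * i = i + (j + k * i - i)" using p(2) by (cases k) (auto simp: k_def)
      then have "g (j + k * i) = f (g (Suc (j + k * i)))" using down by metis
      then show ?thesis using shift[of j i] shift[of "Suc j" i] by simp
    qed
    then show ?thesis by blast
  qed (use adj in blast)
  have invariant: "f y \<in> Z" if yZ: "y \<in> Z" for y
  proof -
    obtain i where "y = g i" using yZ by (auto simp: Z_def)
    then have "y = g (Suc (i + k - 1))" using shift[of i 1] p(2) by (cases k) (auto simp: k_def)
    then show ?thesis using \<open>y = g i\<close> dir unfolding Z_def by (metis rangeI)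
  qed
  have orbit: "\<exists>n. y = (f ^^ n) x" if xy: "x \<in> Z" "y \<in> Z" for x y
  proof -
    obtain i j where ij: "x = g i" "y = g j" using xy by (auto simp: Z_def)
    from dir show ?thesis
    proof
      assume "\<forall>i. g (Suc i) = f (g i)"
      then have "(f ^^ n) (g i) = g (i + n)" for n by (induction n) auto
      moreover have "i + (j + k * i - i) = j + k * i" using p(2) by (cases k) (auto simp: k_def)
      ultimately show ?thesis using ij shift[of j i] by metis
    next
      assume down: "\<forall>i. g i = f (g (Suc i))"
      have "(f ^^ n) (g (j + n)) = g j" for n
      proof (induction n)
        case (Suc n)
        have "(f ^^ Suc n) (g (j + Suc n)) = (f ^^ n) (f (g (Suc (j + n))))"
          by (simp add: funpow_swap1)
        then show ?case using Suc down by metis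
      qed simp
      moreover have "j + (i + k * j - j) = i + k * j" using p(2) by (cases k) (auto simp: k_def)
      ultimately show ?thesis using ij shift[of i j] by metis
    qed
  qed
  have "g 0 \<in> Z" by (simp add: Z_def)
  \<comment> \<open>\<open>z\<close> is an ancestor of all of its block, so the
    \<open>f\<close>-invariant set \<open>Z\<close> contains it. Thus \<open>Z\<close> is the orbit
    of \<open>z\<close>, and the edge set does not depend on \<open>p\<close>.\<close>
  then have zZ: "z \<in> Z"
    using ancestor_of_invariant[of z "g 0" Z] ZV invariant by (auto simp: desc_def)
  then show "z \<in> fst ` set p" by (simp add: fst_p)
  show "f z \<in> V" using invariant[OF zZ] ZV by (auto simp: desc_def)
  have "(f ^^ n) z \<in> Z" for n
    by (induction n) (auto simp: zZ invariant)
  then have Z_eq: "Z = range (\<lambda>n. (f ^^ n) z)"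
    using orbit[OF zZ] by blast
  have "edge_set p = (\<lambda>x. {x, f x}) ` Z"
  proof -
    have es: "edge_set p = range (\<lambda>i. {g i, g (Suc i)})"
      unfolding edge_set_def g by (auto simp: image_image)
    \<comment> \<open>If \<open>f\<close> is the predecessor map, the edge between
      \<open>g i\<close> and \<open>g (Suc i)\<close> is attached to \<open>g (Suc i)\<close>, hence
      the shifted range.\<close>
    have "range (\<lambda>i. g (Suc i)) = Z"
    proof -
      have "g i \<in> range (\<lambda>i. g (Suc i))" for i
      proof (rule image_eqI)
        show "g i = g (Suc (i + k - 1))"
          using shift[of i 1] p(2) by (cases k) (auto simp: k_def)
      qed simp
      then show ?thesis by (auto simp: Z_def)
    qed
    with dir show ?thesis
    proof (elim disjE)
      assume "\<forall>i. g (Suc i) = f (g i)"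
      then show ?thesis by (simp add: es Z_def image_image)
    next
      assume *: "\<forall>i. g i = f (g (Suc i))"
      then have "edge_set p = (\<lambda>x. {x, f x}) ` range (\<lambda>i. g (Suc i))"
        unfolding es image_image by (intro image_cong refl) (metis insert_commute)
      then show ?thesis using \<open>range (\<lambda>i. g (Suc i)) = Z\<close> by simp
    qed
  qed
  then show "edge_set p = (\<lambda>x. {x, f x}) ` range (\<lambda>n. (f ^^ n) z)"
    by (simp only: Z_eq)
qed

lemma cycles_root_block: "z \<in> roots \<Longrightarrow> cycles (block z) = {}"
  using cycle_is_orbit(1) by (auto simp: cycles_def roots_def)

text \<open>A closed walk through \<open>z\<close> yields a cycle; it is unique because
  \<open>cycle_is_orbit\<close> expresses the edge set of any cycle through \<open>z\<close> and
  \<open>f\<close> alone.\<close>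

lemma cycle_periodic_block:
  assumes "z \<in> periodic"
  shows "\<exists>c. cycles (block z) = {edge_set c} \<and> pre_digraph.cycle (with_proj (block z)) c \<and> z \<in> fst ` set c"
proof -
  interpret pair_wf_digraph "block z" by (rule wf_block)
  have "(z, z) \<in> (parcs (block z))\<^sup>+"
    using assms periodic_in_V trancl_block by (auto simp: periodic_def)
  then obtain q where "closed_w q"
    using reachable1_awalk[of z z] by (auto simp: closed_w_def)
  then obtain c where c: "pre_digraph.cycle (with_proj (block z)) c"
    using closed_w_imp_cycle by blast
  then have c': "pre_digraph.cycle (with_proj (mk_symmetric (with_proj (block z)))) c"
    by (auto simp: cycle_pair_iff parcs_mk_symmetric)
  obtain g where g: "set c = range (\<lambda>i. (g i, g (Suc i)))"
    and gm: "\<And>i j. g i = g j \<longleftrightarrow> i mod length c = j mod length c"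
    using cycle_cyclic_sequence[OF c] by metis
  have "set c \<subseteq> R" "c \<noteq> []"
    using c by (auto simp: cycle_pair_iff block_def)
  then have "(g 0, g 1) \<in> R" "(g 1, g 2) \<in> R"
    unfolding g by (auto simp: numeral_2_eq_2)
  \<comment> \<open>\<open>g 0\<close> is \<open>f (f (g 2))\<close>. Excluding equality rules out
    lengths 1 and 2 together, so the cycle is one of the simple graph.\<close>
  then have "g 0 \<noteq> g 2"
    using no_2_cycle[of "g 2"] by (auto simp: R_iff)
  then have "\<not> length c dvd 2"
    by (auto simp: gm)
  then have "length c \<noteq> 1" "length c \<noteq> 2" by auto
  moreover have "length c \<noteq> 0" using \<open>c \<noteq> []\<close> by simp
  ultimately have len: "3 \<le> length c" by linarith
  have "edge_set q = edge_set c"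
    if "pre_digraph.cycle (with_proj (mk_symmetric (with_proj (block z)))) q" "3 \<le> length q" for q
    using cycle_is_orbit(3)[OF that] cycle_is_orbit(3)[OF c' len] by simp
  then have "cycles (block z) \<subseteq> {edge_set c}"
    unfolding cycles_def by blast
  moreover have "edge_set c \<in> cycles (block z)"
    using c' len unfolding cycles_def by blast
  ultimately have "cycles (block z) = {edge_set c}" by blast
  then show ?thesis using c cycle_is_orbit(2)[OF c' len] by blast
qed

section \<open>Blocks as trees and unicycles\<close>

lemma pverts_block: "pverts (block z) = desc z"
  by (simp add: block_def)

lemma arcs_of_blocks: "(\<Union>z\<in>roots \<union> periodic. parcs (block z)) = R"
proof (intro equalityI subsetI)
  fix e assume "e \<in> R"
  then obtain x where x: "e = (f x, x)" "x \<in> V" "f x \<in> V" by (auto simp: R_def)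
  then show "e \<in> (\<Union>z\<in>roots \<union> periodic. parcs (block z))"
    using desc_cover[of x] parent_arc_in_block by blast
qed (auto simp: block_def)

lemma verts_of_blocks: "(\<Union>z\<in>roots \<union> periodic. desc z) = V"
  using desc_cover by (auto simp: desc_def)

lemma deg_block_leaf:
  assumes "x \<in> desc z" "f x \<in> V" "z \<in> roots \<union> periodic" "\<And>y. (x, y) \<notin> R"
  shows "deg (block z) x = 1"
proof -
  have "nbrs (block z) x = {f x}"
    using parent_arc_in_block[OF assms(1-3)] assms(4)
    by (auto simp: nbrs_def out_nbrs_def in_nbrs_def block_def R_iff)
  then show ?thesis by (simp add: deg_def)
qed

lemma root_block_singleton:
  assumes "z \<in> roots" "\<And>y. (z, y) \<notin> R"
  shows "desc z = {z}"
  using assms by (auto simp: desc_def roots_def elim: converse_rtranclE)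

text \<open>By \<open>leaf\<close>, a vertex of weight 1 has no child: its parent is its only
  neighbour, or it is a root that forms the whole block.\<close>

lemma root_oriented_tree_block:
  assumes "subgraph (with_proj (block z)) (with_proj D)" "z \<in> roots"
    and leaf: "\<And>x y. (x, y) \<in> R \<Longrightarrow> w x \<noteq> 1"
  shows "root_oriented_tree D w (block z) z"
proof -
  have zV: "z \<in> V" using assms(2) by (simp add: roots_def)
  have "deg (block z) x = 1 \<and> x \<noteq> z \<or> desc z = {z} \<and> x = z" if "x \<in> desc z" "w x = 1" for x
  proof (cases "x = z")
    case True
    then show ?thesis using root_block_singleton[OF assms(2)] leaf that(2) by blast
  next
    case False
    then have "x \<notin> roots"
      using that(1) ancestor_of_root[of z x] by (auto simp: desc_def)
    then have "f x \<in> V" using that(1) by (auto simp: roots_def desc_def)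
    then show ?thesis
      using deg_block_leaf[OF that(1)] assms(2) leaf that(2) False by blast
  qed
  then show ?thesis
    using assms(1) self_in_desc[OF zV] cycles_root_block[OF assms(2)] apath_block zV
    unfolding root_oriented_tree_def pverts_block by blast
qed

lemma unicycle_oriented_subgraph_block:
  assumes "subgraph (with_proj (block z)) (with_proj D)" "z \<in> periodic"
    and leaf: "\<And>x y. (x, y) \<in> R \<Longrightarrow> w x \<noteq> 1"
  shows "unicycle_oriented_subgraph D w (block z)"
proof -
  have zV: "z \<in> V" using assms(2) by (rule periodic_in_V)
  have "deg (block z) x = 1" if "x \<in> desc z" "w x = 1" for x
  proof -
    have "x \<notin> roots"
      using that(1) ancestor_of_root[of z x] periodic_not_root[OF assms(2)]
      by (auto simp: desc_def roots_def)
    then have "f x \<in> V" using that(1) by (auto simp: roots_def desc_def)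
    then show ?thesis
      using deg_block_leaf[OF that(1)] assms(2) leaf that(2) by blast
  qed
  then have leaves: "\<forall>x\<in>desc z. w x = 1 \<longrightarrow> deg (block z) x = 1" by blast
  obtain c where c: "cycles (block z) = {edge_set c}"
    "pre_digraph.cycle (with_proj (block z)) c" "z \<in> fst ` set c"
    using cycle_periodic_block[OF assms(2)] by blast
  have "\<forall>y \<in> desc z - fst ` set c. \<exists>x \<in> fst ` set c.
      \<exists>p. pre_digraph.apath (with_proj (block z)) x p y"
    using apath_block[OF _ zV] by (intro ballI bexI[OF _ c(3)]) simp
  then show ?thesis
    unfolding unicycle_oriented_subgraph_def pverts_block
    by (intro conjI exI[of _ c] assms(1) c(1,2) leaves)
qed

end

section \<open>From strong covers to semi-forests\<close>

context weighted_oriented_graph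
begin

lemma star_semi_forest_of_strong_cover:
  assumes C: "strong_vertex_cover D w C" and VC: "V \<subseteq> C"
  shows "\<exists>H. star_semi_forest D w H \<and> pverts H = V"
proof -
  have CD: "C \<subseteq> pverts D" and cover: "\<And>x y. (x, y) \<in> parcs D \<Longrightarrow> x \<in> C \<or> y \<in> C"
    using C by (auto simp: strong_vertex_cover_def vertex_cover_def)
  have "\<exists>y. if x \<in> L3 D C then (y, x) \<in> parcs D \<and> y \<in> (C - L1 D C) \<inter> V_plus D w
        else y \<in> nbrs D x \<and> y \<in> pverts D - C" if "x \<in> V" for x
  proof (cases "x \<in> L3 D C")
    case True
    then show ?thesis using C by (auto simp: strong_vertex_cover_def)
  next
    case False
    then show ?thesis
      using that VC by (auto simp: L3_def L2_def L1_def nbrs_def)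
  qed
  then obtain f where f: "\<And>x. x \<in> V \<Longrightarrow>
      if x \<in> L3 D C then (f x, x) \<in> parcs D \<and> f x \<in> (C - L1 D C) \<inter> V_plus D w
        else f x \<in> nbrs D x \<and> f x \<in> pverts D - C"
    by metis
  \<comment> \<open>Whether a parent lies in \<open>C\<close> tells which of the two choices
    produced it.\<close>
  have fC: "(f x, x) \<in> parcs D" "f x \<in> (C - L1 D C) \<inter> V_plus D w" if "x \<in> V" "f x \<in> C" for x
    using f[OF that(1)] that(2) by (auto split: if_splits)
  have fD: "f x \<in> nbrs D x" "f x \<in> pverts D" if "x \<in> V" for x
    using f[OF that] CD by (auto simp: nbrs_def in_nbrs_def split: if_splits)
  interpret parent_map V f
  proof
    show "finite V" using VC CD pair_finite_verts by (meson finite_subset)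
    show "f (f x) \<noteq> x" if "x \<in> V" "f x \<in> V" for x
    proof
      assume "f (f x) = x"
      then have "(x, f x) \<in> parcs D" "(f x, x) \<in> parcs D"
        using fC[of x] fC[of "f x"] that VC by auto
      then show False using oriented by (auto dest: asymD)
    qed
  qed
  have RC: "x \<in> C - L1 D C" "w x \<noteq> 1" "(x, y) \<in> parcs D" if "(x, y) \<in> R" for x y
    using that fC[of y] VC by (auto simp: R_iff V_plus_def)
  define H where "H = \<lparr>pverts = V, parcs = R\<rparr>"
  have wfD: "pair_wf_digraph D" by unfold_locales
  have subH: "subgraph (with_proj H) (with_proj D)"
    using VC CD RC(3) wfD by (auto simp: subgraph_pair_iff H_def pair_wf_digraph_def R_iff)
  have sub_block: "subgraph (with_proj (block z)) (with_proj D)" for z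
    using VC CD RC(3) wfD wf_block by (auto simp: subgraph_pair_iff block_def desc_def)
  have "finite roots" using finite_V by (simp add: roots_def)
  then obtain v where v: "bij_betw v {..<card roots} roots"
    using ex_bij_betw_nat_finite by (metis atLeast0LessThan)
  have "finite periodic" using finite_V periodic_in_V by (meson finite_subset subsetI)
  \<comment> \<open>All vertices of one cycle have the same block, so unicycles are indexed by
    distinct blocks, whereas trees are indexed by their roots.\<close>
  then have "finite (block ` periodic)" by simp
  then obtain B where B: "bij_betw B {..<card (block ` periodic)} (block ` periodic)"
    using ex_bij_betw_nat_finite by (metis atLeast0LessThan)
  define r s where "r = card roots" and "s = card (block ` periodic)"
  have v_img: "v ` {..<r} = roots" and v_inj: "inj_on v {..<r}"
    using v by (auto simp: bij_betw_def r_def)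
  have B_img: "B ` {..<s} = block ` periodic" and B_inj: "inj_on B {..<s}"
    using B by (auto simp: bij_betw_def s_def)
  have v_root: "v i \<in> roots" if "i < r" for i
    using v_img that by blast
  have B_per: "\<exists>z\<in>periodic. B j = block z" if "j < s" for j
    using B_img that by blast
  have unions: "(\<Union>i<r. g (block (v i))) \<union> (\<Union>j<s. g (B j)) = (\<Union>z\<in>roots \<union> periodic. g (block z))"
    for g :: "'a pair_pre_digraph \<Rightarrow> 'b set"
  proof -
    have "(\<Union>i<r. g (block (v i))) = (\<Union>z\<in>v ` {..<r}. g (block z))"
      and "(\<Union>j<s. g (B j)) = (\<Union>G\<in>B ` {..<s}. g G)"
      by simp_all
    then show ?thesis by (simp add: v_img B_img UN_Un)
  qed
  have H: "H = \<lparr>pverts = (\<Union>i<r. pverts (block (v i))) \<union> (\<Union>j<s. pverts (B j)),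
             parcs = (\<Union>i<r. parcs (block (v i))) \<union> (\<Union>j<s. parcs (B j))\<rparr>"
    using unions[of pverts] unions[of parcs] arcs_of_blocks verts_of_blocks
    by (simp add: H_def pverts_block)
  have disjT: "disjoint_family_on (\<lambda>i. pverts (block (v i))) {..<r}"
    using desc_roots_disjoint v_root v_inj
    by (auto simp: disjoint_family_on_def pverts_block inj_on_def)
  have disjB: "disjoint_family_on (\<lambda>j. pverts (B j)) {..<s}"
    unfolding disjoint_family_on_def
  proof (intro ballI impI, rule ccontr)
    fix i j assume ij: "i \<in> {..<s}" "j \<in> {..<s}" "i \<noteq> j" "pverts (B i) \<inter> pverts (B j) \<noteq> {}"
    then obtain a b where ab: "a \<in> periodic" "B i = block a" "b \<in> periodic" "B j = block b"
      using B_per by (metis lessThan_iff)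
    then have "desc a = desc b"
      using ij(4) desc_eqI by (auto simp: pverts_block)
    then have "B i = B j" by (simp add: ab block_def)
    then show False using ij B_inj by (auto simp: inj_on_def)
  qed
  have disjTB: "\<forall>i<r. \<forall>j<s. pverts (block (v i)) \<inter> pverts (B j) = {}"
  proof (intro allI impI, rule ccontr)
    fix i j assume ij: "i < r" "j < s" "pverts (block (v i)) \<inter> pverts (B j) \<noteq> {}"
    then obtain b where "b \<in> periodic" "B j = block b"
      using B_per by metis
    then show False
      using ij desc_roots_disjoint[of _ "v i" b] v_root by (auto simp: pverts_block)
  qed
  define W1 W2 where "W1 = f ` roots - C" and "W2 = f ` roots \<inter> C"
  define H' where "H' = {x \<in> pverts H. 2 \<le> deg H x} \<union> {v i | i. i < r \<and> deg H (v i) = 1}"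
  \<comment> \<open>A vertex without children has at most its parent as neighbour, so in
    \<open>H'\<close> it could only be a root of degree 1; but a childless root is isolated in
    \<open>H\<close>.\<close>
  have arc_H': "\<exists>y. (x, y) \<in> R" if "x \<in> H'" for x
  proof (rule ccontr)
    assume no: "\<nexists>y. (x, y) \<in> R"
    have nbrs: "nbrs H x \<subseteq> {f x}"
      using no by (auto simp: nbrs_def out_nbrs_def in_nbrs_def H_def R_iff)
    then have "deg H x \<le> 1"
      unfolding deg_def using card_mono[of "{f x}"] by fastforce
    then obtain i where "i < r" "x = v i" "deg H x = 1"
      using \<open>x \<in> H'\<close> by (auto simp: H'_def)
    then have "f x \<notin> V" using v_root by (auto simp: roots_def)
    then have "nbrs H x = {}"
      using no by (auto simp: nbrs_def out_nbrs_def in_nbrs_def H_def R_iff)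
    then show False using \<open>deg H x = 1\<close> by (simp add: deg_def)
  qed
  have W2': "W2 \<subseteq> (C - L1 D C) \<inter> V_plus D w"
    using fC by (auto simp: W2_def roots_def)
  then have W2_V: "W2 \<subseteq> V_plus D w" by blast
  \<comment> \<open>Vertices of \<open>W2\<close> and parents of vertices in \<open>V\<close> avoid
    \<open>L1 D C\<close>, so no arc leads from them to \<open>W1\<close>, which lies outside
    \<open>C\<close>.\<close>
  have "out_nbrs D x \<inter> W1 = {}" if "x \<in> W2 \<union> H'" for x
  proof -
    have "x \<in> C - L1 D C" using that W2' arc_H' RC(1) by blast
    moreover have "W1 \<subseteq> pverts D - C" using fD by (auto simp: W1_def roots_def)
    ultimately show ?thesis by (auto simp: L1_def)
  qed
  then have N: "(\<Union>x \<in> W2 \<union> H'. out_nbrs D x) \<inter> W1 = {}" by blast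
  \<comment> \<open>An arc inside \<open>W1\<close> would have both ends outside the cover
    \<open>C\<close>.\<close>
  have stable: "stable_set D W1"
    using fD cover by (fastforce simp: stable_set_def W1_def roots_def nbrs_def out_nbrs_def in_nbrs_def)
  define u where "u = f \<circ> v"
  have W: "W1 \<union> W2 = u ` {..<r}" "W1 \<inter> W2 = {}"
    unfolding W1_def W2_def u_def image_comp[symmetric] v_img by blast+
  have u: "\<forall>i<r. u i \<in> pverts D - pverts H \<and> u i \<in> nbrs D (v i)"
    using v_root fD by (auto simp: u_def H_def roots_def)
  have u2: "\<forall>i<r. u i \<in> W2 \<longrightarrow> (u i, v i) \<in> parcs D"
    using v_root fC by (auto simp: u_def W2_def roots_def)
  have trees: "\<forall>i<r. root_oriented_tree D w (block (v i)) (v i)"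
    using root_oriented_tree_block sub_block v_root RC(2) by blast
  have unis: "\<forall>j<s. unicycle_oriented_subgraph D w (B j)"
    using unicycle_oriented_subgraph_block sub_block B_per RC(2) by metis
  have "star_semi_forest D w H"
    unfolding star_semi_forest_def Let_def
    by (intro conjI subH exI[of _ r] exI[of _ s] exI[of _ "\<lambda>i. block (v i)"] exI[of _ v] exI[of _ B]
        exI[of _ u] exI[of _ W1] exI[of _ W2] trees unis H disjT disjB disjTB u W stable u2 W2_V N[unfolded H'_def])
  then show ?thesis by (auto simp: H_def)
qed

end

theorem theorem3p10:
  fixes D K :: "'a pair_pre_digraph" and w :: "'a \<Rightarrow> nat"
  assumes "weighted_oriented_graph D w"
    and "induced_subgraph K D"
  shows "(\<exists>C. strong_vertex_cover D w C \<and> pverts K \<subseteq> C) \<longleftrightarrow>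
         (\<exists>H. generating_star_semi_forest D w K H)"
proof -
  interpret weighted_oriented_graph D w by (fact assms(1))
  show ?thesis
  proof
    assume "\<exists>C. strong_vertex_cover D w C \<and> pverts K \<subseteq> C"
    then show "\<exists>H. generating_star_semi_forest D w K H"
      unfolding generating_star_semi_forest_def using star_semi_forest_of_strong_cover by blast
  next
    assume "\<exists>H. generating_star_semi_forest D w K H"
    then obtain H where "star_semi_forest D w H" "pverts H = pverts K"
      unfolding generating_star_semi_forest_def by blast
    then show "\<exists>C. strong_vertex_cover D w C \<and> pverts K \<subseteq> C"
      using strong_cover_of_star_semi_forest[of H] by simp
  qed
qed

end
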